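(* Let $\gamma$ be a smooth closed planar curve with strictly positive curvature bounding a convex region, let $M$ be its area evolute, $u$ and $v$ the associated symmetric curves, $N$ the $v$-involute of $M$ and $\beta$ the function defining it (see context). Then the signed areas $SA(M)$ and $SA(N)$ satisfy $$SA(M)-SA(N)=\int_0^{\pi}\beta^2\,[v,v']\,d\theta.$$
   Context: $[w_1,w_2]$ denotes the determinant of the $2\times 2$ matrix with columns $w_1,w_2\in\mathbb{R}^2$, and $e_\theta=(-\sin\theta,\cos\theta)$. The curve $\gamma$ is parameterized by $\theta$ ($2\pi$-periodically) so that $\gamma'(\theta)$ is a positive multiple of $e_\theta$. Put $M(\theta)=\frac12(\gamma(\theta)+\gamma(\theta+\pi))$ (the area evolute of $\gamma$). Fix $k>0$ and put $u(\theta)=\frac{k}{2}(\gamma(\theta)-\gamma(\theta+\pi))$; $u$ is a smooth convex curve, symmetric about the origin ($u(\theta+\pi)=-u(\theta)$), with strictly positive curvature, and $u'(\theta)$ is a positive multiple of $e_\theta$. Put $v(\theta)=u'(\theta)/[u(\theta),u'(\theta)]$; $v$ is also a smooth convex origin-symmetric curve, $[u,v]=1$ and $u=-v'/[v,v']$. The function $\alpha$ is defined by $M'(\theta)=\alpha(\theta)u'(\theta)$. Put $$\beta(\theta)=\tfrac12\int_\theta^{\theta+\pi}\alpha(s)[u,u'](s)\,ds,\qquad N(\theta)=M(\theta)+\beta(\theta)v(\theta).$$ The mixed area of closed curves parameterized by $\theta\in[0,2\pi]$ is $A(\gamma_1,\gamma_2)=\frac12\int_0^{2\pi}[\gamma_1,\gamma_2']\,d\theta$.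 The signed areas are $$SA(M)=-A(M,M)=-\int_0^\pi[M,M']\,d\theta,\qquad SA(N)=-A(N,N)=-\int_0^\pi[N,N']\,d\theta .$$ *)

theory Defs
  imports "HOL-Analysis.Analysis"
begin

abbreviation vderiv :: "(real \<Rightarrow> real^2) \<Rightarrow> real \<Rightarrow> real^2" where
  "vderiv f \<equiv> \<lambda>\<theta>. vector_derivative f (at \<theta>)"

text \<open>Smooth means infinitely differentiable on the whole real line.\<close>

definition smooth :: "(real \<Rightarrow> real^2) \<Rightarrow> bool" where
  "smooth f \<longleftrightarrow> (\<forall>n \<theta>. (vderiv ^^ n) f differentiable (at \<theta>))"

text \<open>The rows of \<^term>\<open>vector [w1, w2]\<close> are w1 and w2, hence the transposition.\<close>

definition bracket :: "real^2 \<Rightarrow> real^2 \<Rightarrow> real" where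
  "bracket w1 w2 = det (transpose (vector [w1, w2] :: real^2^2))"

definition e_vec :: "real \<Rightarrow> real^2" where
  "e_vec \<theta> = vector [- sin \<theta>, cos \<theta>]"

definition curvature :: "(real \<Rightarrow> real^2) \<Rightarrow> real \<Rightarrow> real" where
  "curvature \<gamma> \<theta> = bracket (vderiv \<gamma> \<theta>) (vderiv (vderiv \<gamma>) \<theta>) / norm (vderiv \<gamma> \<theta>) ^ 3"

text \<open>
  The conditions that the curve is simple, encloses a convex region and has positive curvature
  already follow from the remaining ones (the tangent turns around exactly once per period).
\<close>

definition convex_curve :: "(real \<Rightarrow> real^2) \<Rightarrow> bool" where
  "convex_curve \<gamma> \<longleftrightarrow>
     smooth \<gamma> \<and>
     (\<forall>\<theta>. \<gamma> (\<theta> + 2 * pi) = \<gamma> \<theta>) \<and>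
     inj_on \<gamma> {0..<2 * pi} \<and>
     convex (inside (range \<gamma>)) \<and>
     (\<forall>\<theta>. curvature \<gamma> \<theta> > 0) \<and>
     (\<forall>\<theta>. \<exists>c>0. vderiv \<gamma> \<theta> = c *\<^sub>R e_vec \<theta>)"

definition area_evolute :: "(real \<Rightarrow> real^2) \<Rightarrow> real \<Rightarrow> real^2" where
  "area_evolute \<gamma> \<theta> = (1/2) *\<^sub>R (\<gamma> \<theta> + \<gamma> (\<theta> + pi))"

definition u_curve :: "real \<Rightarrow> (real \<Rightarrow> real^2) \<Rightarrow> real \<Rightarrow> real^2" where
  "u_curve k \<gamma> \<theta> = (k/2) *\<^sub>R (\<gamma> \<theta> - \<gamma> (\<theta> + pi))"

definition v_curve :: "real \<Rightarrow> (real \<Rightarrow> real^2) \<Rightarrow> real \<Rightarrow> real^2" where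
  "v_curve k \<gamma> \<theta> =
     (1 / bracket (u_curve k \<gamma> \<theta>) (vderiv (u_curve k \<gamma>) \<theta>)) *\<^sub>R vderiv (u_curve k \<gamma>) \<theta>"

text \<open>
  The factor is well defined: the derivatives of M and u at \<open>\<theta>\<close> are both multiples of \<open>e_vec \<theta>\<close>,
  and that of u does not vanish.
\<close>

definition \<alpha> :: "real \<Rightarrow> (real \<Rightarrow> real^2) \<Rightarrow> real \<Rightarrow> real" where
  "\<alpha> k \<gamma> \<theta> = (THE a. vderiv (area_evolute \<gamma>) \<theta> = a *\<^sub>R vderiv (u_curve k \<gamma>) \<theta>)"

definition \<beta> :: "real \<Rightarrow> (real \<Rightarrow> real^2) \<Rightarrow> real \<Rightarrow> real" where
  "\<beta> k \<gamma> \<theta> = (1/2) * integral {\<theta>..\<theta> + pi}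
     (\<lambda>s. \<alpha> k \<gamma> s * bracket (u_curve k \<gamma> s) (vderiv (u_curve k \<gamma>) s))"

definition v_involute :: "real \<Rightarrow> (real \<Rightarrow> real^2) \<Rightarrow> real \<Rightarrow> real^2" where
  "v_involute k \<gamma> \<theta> = area_evolute \<gamma> \<theta> + \<beta> k \<gamma> \<theta> *\<^sub>R v_curve k \<gamma> \<theta>"

definition mixed_area :: "(real \<Rightarrow> real^2) \<Rightarrow> (real \<Rightarrow> real^2) \<Rightarrow> real" where
  "mixed_area \<gamma>1 \<gamma>2 = (1/2) * integral {0..2 * pi} (\<lambda>\<theta>. bracket (\<gamma>1 \<theta>) (vderiv \<gamma>2 \<theta>))"

text \<open>
  For the \<open>\<pi>\<close>-periodic curves M and N this equals minus the integral of the
  bracket of the curve with its derivative over the half period from 0 to \<open>\<pi>\<close>.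
\<close>

definition signed_area :: "(real \<Rightarrow> real^2) \<Rightarrow> real" where
  "signed_area c = - mixed_area c c"

end

theory Submission
  imports Defs
begin

text \<open>
  Write \<open>w = [u, u']\<close>, so that \<open>u' = w v\<close> and \<open>M' = \<alpha> w v\<close>. Since \<open>\<alpha> w\<close> changes sign under
  \<open>\<theta> \<mapsto> \<theta> + \<pi>\<close>, differentiating its integral over \<open>[\<theta>, \<theta> + \<pi>]\<close> gives \<open>\<beta>' = - \<alpha> w\<close>. Hence
  \<open>M' = - \<beta>' v\<close>, \<open>N' = \<beta> v'\<close> and \<open>[N, N'] - [M, M'] = (\<beta> [M, v])' + \<beta>\<^sup>2 [v, v']\<close>. The total
  derivative integrates to zero over a period, and \<open>\<beta>\<^sup>2 [v, v']\<close> is \<open>\<pi>\<close>-periodic.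
\<close>

section \<open>The planar bracket\<close>

lemma bracket_eq: "bracket x y = x$1 * y$2 - x$2 * y$1"
  by (simp add: bracket_def det_2 transpose_def)

text \<open>Supplies the product rule, continuity and sign rules for \<open>bracket\<close>. Each of
  the two products in the coordinate formula is at most \<open>norm a * norm b\<close>, whence the
  constant 2.\<close>

interpretation bracket: bounded_bilinear bracket
proof
  show "\<exists>K. \<forall>a b. norm (bracket a b) \<le> norm a * norm b * K"
  proof (intro exI allI)
    fix a b :: "real^2"
    have "\<bar>bracket a b\<bar> \<le> \<bar>a$1\<bar> * \<bar>b$2\<bar> + \<bar>a$2\<bar> * \<bar>b$1\<bar>"
      unfolding bracket_eq abs_mult[symmetric] by linarith
    also have "\<dots> \<le> norm a * norm b + norm a * norm b"
      by (intro add_mono mult_mono component_le_norm_cart) auto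
    finally show "norm (bracket a b) \<le> norm a * norm b * 2" by simp
  qed
qed (auto simp: bracket_eq algebra_simps)

lemma bracket_self [simp]: "bracket x x = 0"
  by (simp add: bracket_eq)

section \<open>Calculus of periodic functions and the area identity\<close>

lemma has_vector_derivative_shift:
  assumes "\<And>t. (f has_vector_derivative f' t) (at t)"
  shows "((\<lambda>t. f (t + c)) has_vector_derivative f' (t + c)) (at t)"
proof -
  have "((\<lambda>s. s + c) has_vector_derivative 1 + 0) (at t)"
    by (intro has_vector_derivative_add has_vector_derivative_id has_vector_derivative_const)
  then show ?thesis
    using vector_diff_chain_at[of "\<lambda>s. s + c" 1 t f "f' (t + c)"] assms by (simp add: o_def)
qed

lemma integral_double_period:
  fixes f :: "real \<Rightarrow> real"
  assumes "continuous_on UNIV f" "\<And>x. f (x + p) = f x" "0 \<le> p"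
  shows "integral {0..2 * p} f = 2 * integral {0..p} f"
proof -
  have "f integrable_on {0..2 * p}"
    using assms(1) continuous_on_subset integrable_continuous_real by blast
  then have "integral {0..2 * p} f = integral {0..p} f + integral {0 + p..p + p} f"
    using Henstock_Kurzweil_Integration.integral_combine[of 0 p "2 * p" f] assms(3) by simp
  also have "integral {0 + p..p + p} f = integral {0..p} (f \<circ> (\<lambda>x. x + p))"
    by (intro integral_shift[symmetric] continuous_on_subset[OF assms(1)]) auto
  also have "f \<circ> (\<lambda>x. x + p) = f" using assms(2) by auto
  finally show ?thesis by simp
qed

text \<open>For an antiderivative F of f the window integral is \<open>F (x + p) - F x\<close>; both
  endpoints move, so both contribute to the derivative.\<close>

lemma has_real_derivative_window_integral:
  fixes f :: "real \<Rightarrow> real"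
  assumes f: "continuous_on UNIV f" and p: "0 \<le> p"
  shows "((\<lambda>x. integral {x..x + p} f) has_real_derivative f (x + p) - f x) (at x)"
proof -
  \<comment> \<open>The base point lies strictly to the left of x, so that F has a two-sided
    derivative at x itself.\<close>
  define F where "F = (\<lambda>y. integral {x - 1..y} f)"
  have F: "(F has_real_derivative f y) (at y)" if "y > x - 1" for y
  proof -
    have "(F has_real_derivative f y) (at y within {x - 1..y + 1})"
      unfolding F_def
      by (intro integral_has_real_derivative continuous_on_subset[OF f]) (use that in auto)
    then show ?thesis using that by (simp add: at_within_Icc_at)
  qed
  have "((\<lambda>y. F (y + p)) has_real_derivative f (x + p)) (at x)"
    using F[of "x + p"] p by (simp add: DERIV_shift)
  then have "((\<lambda>y. F (y + p) - F y) has_real_derivative f (x + p) - f x) (at x)"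
    by (intro DERIV_diff F) auto
  then show ?thesis
  proof (rule has_field_derivative_transform_within_open[where S = "{x - 1<..}"])
    fix y assume "y \<in> {x - 1<..}"
    moreover have "f integrable_on {x - 1..y + p}"
      using f continuous_on_subset integrable_continuous_real by blast
    ultimately show "F (y + p) - F y = integral {y..y + p} f"
      unfolding F_def
      using Henstock_Kurzweil_Integration.integral_combine[of "x - 1" y "y + p" f] p by simp
  qed auto
qed

text \<open>Separates the calculus from the geometry: the convex curve enters only through M' being
  \<open>- b\<close> times v, with b the derivative of \<beta>, and through the signs under a half
  turn.\<close>

lemma signed_area_diff_involute:
  fixes M v v' :: "real \<Rightarrow> real^2" and \<beta> b :: "real \<Rightarrow> real"
  assumes M: "\<And>t. (M has_vector_derivative - b t *\<^sub>R v t) (at t)"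
    and v: "\<And>t. (v has_vector_derivative v' t) (at t)"
    and \<beta>: "\<And>t. (\<beta> has_real_derivative b t) (at t)"
    and cont: "continuous_on UNIV v'" "continuous_on UNIV b"
    and per: "\<And>t. M (t + pi) = M t" "\<And>t. v (t + pi) = - v t" "\<And>t. \<beta> (t + pi) = - \<beta> t"
  shows "signed_area M - signed_area (\<lambda>t. M t + \<beta> t *\<^sub>R v t) =
    integral {0..pi} (\<lambda>t. (\<beta> t)\<^sup>2 * bracket (v t) (v' t))"
proof -
  define N where "N = (\<lambda>t. M t + \<beta> t *\<^sub>R v t)"
  note \<beta>' = \<beta>[THEN has_real_derivative_iff_has_vector_derivative[THEN iffD1]]
  \<comment> \<open>The two terms in \<open>b t\<close> cancel, so the derivative of N is parallel
    to that of v.\<close>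
  have "((\<lambda>t. M t + \<beta> t *\<^sub>R v t) has_vector_derivative
      - b t *\<^sub>R v t + (\<beta> t *\<^sub>R v' t + b t *\<^sub>R v t)) (at t)" for t
    by (intro has_vector_derivative_add has_vector_derivative_scaleR M v \<beta>)
  then have N: "(N has_vector_derivative \<beta> t *\<^sub>R v' t) (at t)" for t
    by (simp add: N_def)
  have [continuous_intros]: "continuous_on UNIV M" "continuous_on UNIV v" "continuous_on UNIV \<beta>"
    using M v \<beta>' by (auto intro!: has_vector_derivative_continuous continuous_at_imp_continuous_on)
  have [continuous_intros]: "continuous_on UNIV N"
    unfolding N_def by (intro continuous_intros)
  note [continuous_intros] = cont bracket.continuous_on
  define f where "f = (\<lambda>t. \<beta> t * bracket (M t) (v t))"
  define g where "g = (\<lambda>t. (\<beta> t)\<^sup>2 * bracket (v t) (v' t))"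
  define h where "h = (\<lambda>t. bracket (M t) (- b t *\<^sub>R v t))"
  define n where "n = (\<lambda>t. bracket (N t) (\<beta> t *\<^sub>R v' t))"
  have f: "(f has_vector_derivative n t - h t - g t) (at t)" for t
  proof -
    \<comment> \<open>The inner bracket with \<open>- b t *\<^sub>R v t\<close> vanishes because M'
      is parallel to v.\<close>
    have "(f has_vector_derivative
        \<beta> t * (bracket (M t) (v' t) + bracket (- b t *\<^sub>R v t) (v t)) + b t * bracket (M t) (v t)) (at t)"
      unfolding f_def
      by (intro has_vector_derivative_mult \<beta>' bracket.has_vector_derivative M v)
    then show ?thesis
      by (simp add: n_def h_def g_def N_def bracket.add_left bracket.scaleR_left
          bracket.scaleR_right bracket.minus_left bracket.minus_right algebra_simps power2_eq_square)
  qed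
  have int: "q integrable_on {0..2 * pi}" if "continuous_on UNIV q" for q :: "real \<Rightarrow> real"
    using that continuous_on_subset integrable_continuous_real by blast
  have cg: "continuous_on UNIV g" unfolding g_def by (intro continuous_intros)
  have ch: "continuous_on UNIV h" unfolding h_def by (intro continuous_intros)
  have cn: "continuous_on UNIV n" unfolding n_def by (intro continuous_intros)
  \<comment> \<open>\<beta> and v both change sign under a half turn while M does not, so f takes
    equal values at 0, pi and 2 pi.\<close>
  have f2: "f (2 * pi) = f 0"
    using per[of 0] per[of pi]
    by (simp add: f_def bracket.minus_left bracket.minus_right)
  have "((\<lambda>t. n t - h t - g t) has_integral f (2 * pi) - f 0) {0..2 * pi}"
    by (rule fundamental_theorem_of_calculus) (auto intro: f has_vector_derivative_at_within)
  then have "0 = integral {0..2 * pi} (\<lambda>t. n t - h t - g t)"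
    using f2 by (simp add: integral_unique)
  also have "\<dots> = integral {0..2 * pi} n - integral {0..2 * pi} h - integral {0..2 * pi} g"
    by (simp add: integral_diff integrable_diff int cg ch cn)
  finally have *: "integral {0..2 * pi} n - integral {0..2 * pi} h = integral {0..2 * pi} g"
    by simp
  \<comment> \<open>Comes from differentiating \<open>v (s + pi) = - v s\<close>; it makes g
    pi-periodic.\<close>
  have v'_per: "v' (t + pi) = - v' t" for t
  proof (rule vector_derivative_unique_at)
    show "((\<lambda>s. v (s + pi)) has_vector_derivative v' (t + pi)) (at t)"
      by (intro has_vector_derivative_shift v)
    show "((\<lambda>s. v (s + pi)) has_vector_derivative - v' t) (at t)"
      unfolding per(2) by (intro has_vector_derivative_minus v)
  qed
  \<comment> \<open>The factor 2 cancels the 1/2 in \<open>mixed_area\<close>.\<close>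
  have "integral {0..2 * pi} g = 2 * integral {0..pi} g"
    by (rule integral_double_period[OF cg])
      (auto simp: g_def per v'_per bracket.minus_left bracket.minus_right)
  with * show ?thesis
    unfolding signed_area_def mixed_area_def N_def[symmetric] g_def[symmetric]
      vector_derivative_at[OF M] vector_derivative_at[OF N]
    unfolding h_def[symmetric] n_def[symmetric]
    by simp
qed

section \<open>The convex curve and its associated curves\<close>

lemma has_vector_derivative_vderiv:
  assumes "smooth \<gamma>"
  shows "((vderiv ^^ n) \<gamma> has_vector_derivative (vderiv ^^ Suc n) \<gamma> t) (at t)"
  using assms by (simp add: smooth_def vector_derivative_works)

lemma e_vec_add_pi: "e_vec (t + pi) = - e_vec t"
  by (simp add: e_vec_def vec_eq_iff forall_2)

lemma e_vec_nz: "e_vec t \<noteq> 0"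
proof
  assume "e_vec t = 0"
  then have "e_vec t $ 1 = 0" "e_vec t $ 2 = 0" by simp_all
  then show False using sin_cos_squared_add[of t] by (simp add: e_vec_def)
qed

text \<open>The component of \<open>\<gamma>\<close> normal to \<open>e_vec t\<close> decreases strictly on the half turn after \<open>t\<close>.\<close>

lemma bracket_opposite_points_pos:
  assumes \<gamma>: "\<And>s. (\<gamma> has_vector_derivative c s *\<^sub>R e_vec s) (at s)" and c: "\<And>s. c s > 0"
  shows "bracket (\<gamma> t - \<gamma> (t + pi)) (e_vec t) > 0"
proof -
  let ?f = "\<lambda>s. bracket (\<gamma> s) (e_vec t)"
  \<comment> \<open>The bracket of \<open>e_vec s\<close> with \<open>e_vec t\<close> is
    \<open>sin (t - s)\<close>.\<close>
  have f: "(?f has_real_derivative c s * sin (t - s)) (at s)" for s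
  proof -
    have "(?f has_vector_derivative bracket (\<gamma> s) 0 + bracket (c s *\<^sub>R e_vec s) (e_vec t)) (at s)"
      by (intro bracket.has_vector_derivative \<gamma> has_vector_derivative_const)
    then show ?thesis
      by (simp add: has_real_derivative_iff_has_vector_derivative bracket_eq e_vec_def
          sin_diff algebra_simps)
  qed
  have "?f (t + pi) < ?f t"
  proof (rule DERIV_neg_imp_decreasing_open[where f = ?f])
    fix s assume s: "t < s" "s < t + pi"
    then have "sin (s - t) > 0" by (intro sin_gt_zero) auto
    then have "sin (t - s) < 0" using sin_minus[of "s - t"] by simp
    then show "\<exists>y. DERIV ?f s :> y \<and> y < 0" using f c by (meson mult_pos_neg)
  qed (use f in \<open>auto intro!: DERIV_isCont continuous_at_imp_continuous_on\<close>)
  then show ?thesis by (simp add: bracket.diff_left)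
qed

theorem proposition4p1:
  fixes \<gamma> :: "real \<Rightarrow> real^2" and k :: real
  assumes "convex_curve \<gamma>" and "k > 0"
  shows "signed_area (area_evolute \<gamma>) - signed_area (v_involute k \<gamma>) =
    integral {0..pi} (\<lambda>\<theta>. (\<beta> k \<gamma> \<theta>)\<^sup>2 * bracket (v_curve k \<gamma> \<theta>) (vderiv (v_curve k \<gamma>) \<theta>))"
proof -
  have sm: "smooth \<gamma>" and per: "\<gamma> (t + 2 * pi) = \<gamma> t"
    and tangent: "\<exists>c>0. vderiv \<gamma> t = c *\<^sub>R e_vec t" for t
    using assms(1) by (auto simp: convex_curve_def)
  obtain c where c: "\<And>t. c t > 0" "\<And>t. vderiv \<gamma> t = c t *\<^sub>R e_vec t"
    using tangent by metis
  define g1 g2 where "g1 = vderiv \<gamma>" and "g2 = vderiv (vderiv \<gamma>)"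
  have g0: "(\<gamma> has_vector_derivative g1 t) (at t)"
    and g1: "(g1 has_vector_derivative g2 t) (at t)" for t
    using has_vector_derivative_vderiv[OF sm, of 0] has_vector_derivative_vderiv[OF sm, of 1]
    by (simp_all add: g1_def g2_def)
  have "continuous_on UNIV g2"
    using has_vector_derivative_vderiv[OF sm, of 2]
    by (auto simp: g2_def numeral_2_eq_2 intro!: continuous_at_imp_continuous_on
        has_vector_derivative_continuous)
  define M u v where "M = area_evolute \<gamma>" and "u = u_curve k \<gamma>" and "v = v_curve k \<gamma>"
  define M1 where "M1 = (\<lambda>t. (1/2) *\<^sub>R (g1 t + g1 (t + pi)))"
  define u1 where "u1 = (\<lambda>t. (k/2) *\<^sub>R (g1 t - g1 (t + pi)))"
  define u2 where "u2 = (\<lambda>t. (k/2) *\<^sub>R (g2 t - g2 (t + pi)))"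
  note scale = bounded_linear.has_vector_derivative[OF bounded_linear_scaleR_right]
  have M: "(M has_vector_derivative M1 t) (at t)" for t
    unfolding M_def area_evolute_def[abs_def] M1_def
    by (intro scale has_vector_derivative_add g0 has_vector_derivative_shift)
  have u: "(u has_vector_derivative u1 t) (at t)" for t
    unfolding u_def u_curve_def[abs_def] u1_def
    by (intro scale has_vector_derivative_diff g0 has_vector_derivative_shift)
  have u1: "(u1 has_vector_derivative u2 t) (at t)" for t
    unfolding u1_def u2_def
    by (intro scale has_vector_derivative_diff g1 has_vector_derivative_shift)
  have deriv_M: "vderiv M t = M1 t" and deriv_u: "vderiv u t = u1 t" for t
    using M u by (auto intro: vector_derivative_at)
  have g1_per: "g1 (t + 2 * pi) = g1 t" for t
  proof -
    have "((\<lambda>s. \<gamma> (s + 2 * pi)) has_vector_derivative g1 (t + 2 * pi)) (at t)"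
      by (intro has_vector_derivative_shift g0)
    then have "(\<gamma> has_vector_derivative g1 (t + 2 * pi)) (at t)"
      unfolding per .
    then show ?thesis
      by (rule vector_derivative_unique_at) (rule g0)
  qed
  have M_per: "M (t + pi) = M t" "M1 (t + pi) = M1 t"
    and u_per: "u (t + pi) = - u t" "u1 (t + pi) = - u1 t" for t
    using per[of t] g1_per[of t]
    by (simp_all add: M_def area_evolute_def u_def u_curve_def M1_def u1_def scaleR_diff_right
        add.commute)
  have g1_e: "g1 t = c t *\<^sub>R e_vec t" for t using c by (simp add: g1_def)
  \<comment> \<open>Coordinates of M' and u' along \<open>e_vec t\<close>. As \<open>e_vec\<close>
    changes sign under a half turn, the sum of tangents in M1 yields a difference of speeds, and the
    difference in u1 yields a sum, which is positive.\<close>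
  define m where "m = (\<lambda>t. (c t - c (t + pi)) / 2)"
  define l where "l = (\<lambda>t. (k/2) * (c t + c (t + pi)))"
  have M1_e: "M1 t = m t *\<^sub>R e_vec t" and u1_e: "u1 t = l t *\<^sub>R e_vec t" for t
    by (simp_all add: M1_def u1_def m_def l_def g1_e e_vec_add_pi vec_eq_iff field_simps)
  have l_pos: "l t > 0" for t
    using c(1) assms(2) by (simp add: l_def add_pos_pos)
  have u1_nz: "u1 t \<noteq> 0" for t
    using l_pos[of t] e_vec_nz[of t] by (simp add: u1_e)
  define w where "w = (\<lambda>t. bracket (u t) (u1 t))"
  \<comment> \<open>Up to the positive factor \<open>(k/2) * l t\<close>, \<open>w t\<close> is the
    bracket of the chord between opposite points with \<open>e_vec t\<close>.\<close>
  have w_pos: "w t > 0" for t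
    using bracket_opposite_points_pos[of \<gamma> c t] g0 c(1) l_pos[of t] assms(2)
    by (simp add: w_def u1_e u_def u_curve_def g1_e bracket.scaleR_left bracket.scaleR_right)
  have v_eq: "v t = (1 / w t) *\<^sub>R u1 t" for t
    by (simp add: v_def v_curve_def w_def deriv_u[unfolded u_def] u_def)
  \<comment> \<open>The first equation shows that the definite description is met. The quotient of
    inner products is a closed form from which continuity and the sign change under a half turn can
    be read off.\<close>
  have \<alpha>: "M1 t = \<alpha> k \<gamma> t *\<^sub>R u1 t" "\<alpha> k \<gamma> t = inner (M1 t) (u1 t) / inner (u1 t) (u1 t)" for t
  proof -
    have ex: "M1 t = (m t / l t) *\<^sub>R u1 t"
      using l_pos[of t] by (simp add: M1_e u1_e)
    have "\<alpha> k \<gamma> t = m t / l t"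
      unfolding \<alpha>_def M_def[symmetric] u_def[symmetric] deriv_M deriv_u
      by (rule the_equality) (use ex u1_nz[of t] in auto)
    with ex show "M1 t = \<alpha> k \<gamma> t *\<^sub>R u1 t" by simp
    then show "\<alpha> k \<gamma> t = inner (M1 t) (u1 t) / inner (u1 t) (u1 t)"
      using u1_nz[of t] by simp
  qed
  have [continuous_intros]: "continuous_on UNIV u" "continuous_on UNIV u1" "continuous_on UNIV g1"
    using u u1 g1 by (auto intro!: has_vector_derivative_continuous continuous_at_imp_continuous_on)
  note [continuous_intros] = bracket.continuous_on continuous_on_compose2[OF \<open>continuous_on UNIV g1\<close>]
    continuous_on_compose2[OF \<open>continuous_on UNIV g2\<close>]
  have w_nz: "w t \<noteq> 0" for t using w_pos[of t] by simp
  have [continuous_intros]: "continuous_on UNIV w" "continuous_on UNIV u2" "continuous_on UNIV M1"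
    unfolding w_def u2_def M1_def by (intro continuous_intros subset_UNIV)+
  have "continuous_on UNIV (\<alpha> k \<gamma>)"
    unfolding \<alpha>(2)[abs_def] by (intro continuous_intros) (simp add: u1_nz)
  \<comment> \<open>This will be the derivative of \<beta>: b changes sign under a half turn, since
    \<open>\<alpha> k \<gamma>\<close> does and w does not.\<close>
  define b where "b = (\<lambda>t. - (\<alpha> k \<gamma> t * w t))"
  have b: "continuous_on UNIV b"
    unfolding b_def by (intro continuous_intros \<open>continuous_on UNIV (\<alpha> k \<gamma>)\<close>)
  have b_per: "b (t + pi) = - b t" for t
    by (simp add: b_def \<alpha>(2) w_def M_per u_per bracket.minus_left bracket.minus_right)
  have \<beta>_eq: "\<beta> k \<gamma> = (\<lambda>t. - (1/2) * integral {t..t + pi} b)"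
    by (simp add: \<beta>_def[abs_def] b_def w_def deriv_u[unfolded u_def] u_def)
  have \<beta>: "(\<beta> k \<gamma> has_real_derivative b t) (at t)" for t
    unfolding \<beta>_eq
    \<comment> \<open>The window derivative \<open>b (t + pi) - b t\<close> equals
      \<open>- 2 * b t\<close>, and the prefactor \<open>- (1/2)\<close> turns it into
      \<open>b t\<close>.\<close>
    using DERIV_cmult[OF has_real_derivative_window_integral[OF b], of pi "- (1/2)" t]
    by (simp add: b_per)
  have \<beta>_per: "\<beta> k \<gamma> (t + pi) = - \<beta> k \<gamma> t" for t
  proof -
    have "integral {t + pi..t + pi + pi} b = integral {t..t + pi} (b \<circ> (\<lambda>x. x + pi))"
      by (intro integral_shift[symmetric] continuous_on_subset[OF b]) auto
    also have "b \<circ> (\<lambda>x. x + pi) = (\<lambda>x. - b x)" using b_per by auto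
    finally show ?thesis by (simp add: \<beta>_eq)
  qed
  \<comment> \<open>Quotient rule for \<open>u1 / w\<close>; the derivative of w is
    \<open>bracket (u t) (u2 t)\<close> because the bracket of u1 with itself vanishes.\<close>
  define v' where "v' = (\<lambda>t. (1 / w t) *\<^sub>R u2 t - (bracket (u t) (u2 t) / (w t)\<^sup>2) *\<^sub>R u1 t)"
  have v': "continuous_on UNIV v'"
    unfolding v'_def by (intro continuous_intros) (auto simp: w_nz)
  have v: "(v has_vector_derivative v' t) (at t)" for t
  proof -
    have "(w has_vector_derivative bracket (u t) (u2 t) + bracket (u1 t) (u1 t)) (at t)"
      unfolding w_def by (intro bracket.has_vector_derivative u u1)
    then have "(w has_real_derivative bracket (u t) (u2 t)) (at t)"
      by (simp add: has_real_derivative_iff_has_vector_derivative)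
    then have "((\<lambda>t. 1 / w t) has_real_derivative - (bracket (u t) (u2 t) / (w t)\<^sup>2)) (at t)"
      using w_nz[of t] by (auto intro!: derivative_eq_intros simp: power2_eq_square)
    then have "((\<lambda>t. (1 / w t) *\<^sub>R u1 t) has_vector_derivative
        (1 / w t) *\<^sub>R u2 t + - (bracket (u t) (u2 t) / (w t)\<^sup>2) *\<^sub>R u1 t) (at t)"
      by (intro has_vector_derivative_scaleR u1)
    then show ?thesis by (simp add: v'_def v_eq[abs_def])
  qed
  \<comment> \<open>Substitutes \<open>u1 t = w t *\<^sub>R v t\<close> into
    \<open>M1 t = \<alpha> k \<gamma> t *\<^sub>R u1 t\<close>.\<close>
  have M': "(M has_vector_derivative - b t *\<^sub>R v t) (at t)" for t
    using M[of t] w_nz[of t] by (simp add: \<alpha>(1) b_def v_eq)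
  have v_per: "v (t + pi) = - v t" for t
    by (simp add: v_eq w_def u_per bracket.minus_left bracket.minus_right)
  have "v_involute k \<gamma> = (\<lambda>t. M t + \<beta> k \<gamma> t *\<^sub>R v t)"
    by (simp add: v_involute_def[abs_def] M_def v_def)
  then show ?thesis
    unfolding M_def[symmetric] v_def[symmetric] vector_derivative_at[OF v]
    using signed_area_diff_involute[OF M' v \<beta> v' b M_per(1) v_per \<beta>_per] by simp
qed

end
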